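(* Let $\mathcal{M}=\langle \mathcal{S},\mathcal{A},p,r,\gamma\rangle$ be a finite Markov decision process with finite state space $\mathcal{S}$, finite action space $\mathcal{A}$, transition probabilities $p(\cdot\mid s,a)$, bounded reward function $r:\mathcal{S}\times\mathcal{A}\times\mathcal{S}\to[-1,1]$ and discount factor $\gamma\in[0,1]$. Let $\pi:\mathcal{S}\to\Delta(\mathcal{A})$ be a target policy, let $H\ge 1$ be an integer, and let $(\beta_t)_{t\ge 0}$, $\beta_t:\mathcal{S}\to\Delta(\mathcal{A})$, be a sequence of behavioral policies. Let $(s_t,a_t)_{t\ge0}$ be the trajectory generated by $a_t\sim\beta_t(\cdot\mid s_t)$ and $s_{t+1}\sim p(\cdot\mid s_t,a_t)$. For each $h\in\{1,\dots,H\}$ let $\hat Q_h^{(t)}$, $t\ge 0$, be the fixed-horizon temporal-difference (FHTD) iterates with learning rates $\alpha_{t,h}(s,a)$ defined in the context. Assume that: (i) the behavioral policies ensure that, almost surely, every state-action pair $(s,a)\in\mathcal{S}\times\mathcal{A}$ is visited infinitely often, i.e. $(s_t,a_t)=(s,a)$ for infinitely many $t$; (ii) for every $h\in\{1,\dots,H\}$ and every $(s,a)$, the sequence $(\alpha_{t,h}(s,a))_{t\ge0}$ is positive and non-increasing in $t$, and, writing $t_1<t_2<\cdots$ for the successive times at which $(s_t,a_t)=(s,a)$, almost surely $$\sum_{n=1}^\infty \alpha_{t_n,h}(s,a)=\infty,\qquad \sum_{n=1}^\infty \alpha_{t_n,h}(s,a)^2<\infty .$$ Then for every $h\in\{1,\dots,H\}$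 and every $(s,a)\in\mathcal{S}\times\mathcal{A}$, $$\lim_{t\to\infty}\hat Q_h^{(t)}(s,a)=Q_h^\pi(s,a)\quad\text{almost surely.}$$
   Context: $\Delta(\mathcal{A})$ is the set of probability distributions on $\mathcal{A}$. Fixed-horizon value function. For $h\ge 1$, $$Q_h^\pi(s,a)=\mathbb{E}\Big[\sum_{t=0}^{h-1}\gamma^t\, r(S_t,A_t,S_{t+1})\;\Big|\;S_0=s,\ A_0=a\Big],$$ where $S_{t+1}\sim p(\cdot\mid S_t,A_t)$ for $t\ge 0$ and $A_t\sim\pi(\cdot\mid S_t)$ for $t=1,\dots,h-1$. Also $Q_0^\pi\equiv 0$. FHTD iterates. The behavioral trajectory starts from an arbitrary initial state. At each time $t$, given the entire past up to and including $(s_t,a_t)$, the next state $s_{t+1}$ is drawn from $p(\cdot\mid s_t,a_t)$; the reward is $r_t=r(s_t,a_t,s_{t+1})$; and then, given all of this, an auxiliary action $a'_{t+1}\sim\pi(\cdot\mid s_{t+1})$ is drawn from the target policy (it is used only in the update target; the action actually executed at time $t+1$ is drawn from $\beta_{t+1}$). Set $\hat Q_0^{(t)}\equiv 0$ for all $t$, and let $\hat Q_h^{(0)}\in\mathbb{R}^{|\mathcal{S}|\times|\mathcal{A}|}$ be an arbitrary deterministic initialization for $h=1,\dots,H$. For $t\ge0$ and $h=1,\dots,H$, simultaneously, $$\hat Q_h^{(t+1)}(s,a)=\begin{cases}\hat Q_h^{(t)}(s,a)+\alpha_{t,h}(s,a)\big(r_t+\gamma\,\hat Q_{h-1}^{(t)}(s_{t+1},a'_{t+1})-\hat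 Q_h^{(t)}(s,a)\big), & (s,a)=(s_t,a_t),\\ \hat Q_h^{(t)}(s,a), & \text{otherwise.}\end{cases}$$ The learning rates $\alpha_{t,h}(s,a)$ are real numbers which may be deterministic or may depend on the history up to and including $(s_t,a_t)$, but not on anything drawn afterwards. *)

theory Defs
  imports "HOL-Probability.Probability"
begin

(* Law of (S_0,A_0), ..., (S_n,A_n) started in (S_0,A_0) = (s,a), with S_{t+1} ~ p(. | S_t, A_t)
   and A_{t+1} ~ pi(. | S_{t+1}). *)
primrec rollout ::
  "('s \<Rightarrow> 'a \<Rightarrow> 's pmf) \<Rightarrow> ('s \<Rightarrow> 'a pmf) \<Rightarrow> nat \<Rightarrow> 's \<Rightarrow> 'a \<Rightarrow> ('s \<times> 'a) list pmf" where
  "rollout p \<pi> 0 s a = return_pmf [(s, a)]"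
| "rollout p \<pi> (Suc n) s a =
     bind_pmf (p s a) (\<lambda>s'. bind_pmf (\<pi> s') (\<lambda>a'. map_pmf ((#) (s, a)) (rollout p \<pi> n s' a')))"

(* The last action of the rollout does not enter the return. *)
definition Q_value ::
  "('s \<Rightarrow> 'a \<Rightarrow> 's pmf) \<Rightarrow> ('s \<Rightarrow> 'a \<Rightarrow> 's \<Rightarrow> real) \<Rightarrow> real \<Rightarrow> ('s \<Rightarrow> 'a pmf) \<Rightarrow>
    nat \<Rightarrow> 's \<Rightarrow> 'a \<Rightarrow> real" where
  "Q_value p r \<gamma> \<pi> h s a =
     measure_pmf.expectation (rollout p \<pi> h s a)
       (\<lambda>xs. \<Sum>t<h. \<gamma> ^ t * r (fst (xs ! t)) (snd (xs ! t)) (fst (xs ! Suc t)))"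

(* The rewards are functions of the recorded states and actions.  There is no auxiliary action
   at time 0, so U 0 is never used. *)
type_synonym ('s, 'a) history = "('s \<times> 'a) list \<times> 'a list"

definition history ::
  "(nat \<Rightarrow> 'w \<Rightarrow> 's) \<Rightarrow> (nat \<Rightarrow> 'w \<Rightarrow> 'a) \<Rightarrow> (nat \<Rightarrow> 'w \<Rightarrow> 'a) \<Rightarrow> nat \<Rightarrow> 'w \<Rightarrow> ('s, 'a) history"
  where
  "history S A U t \<omega> =
     (map (\<lambda>i. (S i \<omega>, A i \<omega>)) [0..<Suc t], map (\<lambda>i. U i \<omega>) [1..<Suc t])"

(* S t and A t are the behavioural trajectory, U (Suc t) is the auxiliary action drawn at
   S (Suc t) from the target policy.  The law of S 0 is arbitrary. *)
locale behaviour_process = prob_space M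
  for M :: "'w measure"
    and p :: "'s::finite \<Rightarrow> 'a::finite \<Rightarrow> 's pmf"
    and \<pi> :: "'s \<Rightarrow> 'a pmf"
    and \<beta> :: "nat \<Rightarrow> 's \<Rightarrow> 'a pmf"
    and S :: "nat \<Rightarrow> 'w \<Rightarrow> 's"
    and A :: "nat \<Rightarrow> 'w \<Rightarrow> 'a"
    and U :: "nat \<Rightarrow> 'w \<Rightarrow> 'a" +
  assumes S_measurable: "\<And>t. S t \<in> measurable M (count_space UNIV)"
    and A_measurable: "\<And>t. A t \<in> measurable M (count_space UNIV)"
    and U_measurable: "\<And>t. U (Suc t) \<in> measurable M (count_space UNIV)"
    and initial_action:
      "\<And>s a. \<P>(\<omega> in M. S 0 \<omega> = s) \<noteq> 0 \<Longrightarrow>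
         \<P>(\<omega> in M. A 0 \<omega> = a \<bar> S 0 \<omega> = s) = pmf (\<beta> 0 s) a"
    and next_state:
      "\<And>t xs s a us s'.
         \<P>(\<omega> in M. history S A U t \<omega> = (xs @ [(s, a)], us)) \<noteq> 0 \<Longrightarrow>
         \<P>(\<omega> in M. S (Suc t) \<omega> = s' \<bar> history S A U t \<omega> = (xs @ [(s, a)], us)) = pmf (p s a) s'"
    and auxiliary_action:
      "\<And>t \<eta> s' u.
         \<P>(\<omega> in M. history S A U t \<omega> = \<eta> \<and> S (Suc t) \<omega> = s') \<noteq> 0 \<Longrightarrow>
         \<P>(\<omega> in M. U (Suc t) \<omega> = u \<bar> history S A U t \<omega> = \<eta> \<and> S (Suc t) \<omega> = s') = pmf (\<pi> s') u"
    and next_action: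
      "\<And>t \<eta> s' u a'.
         \<P>(\<omega> in M. history S A U t \<omega> = \<eta> \<and> S (Suc t) \<omega> = s' \<and> U (Suc t) \<omega> = u) \<noteq> 0 \<Longrightarrow>
         \<P>(\<omega> in M. A (Suc t) \<omega> = a' \<bar>
             history S A U t \<omega> = \<eta> \<and> S (Suc t) \<omega> = s' \<and> U (Suc t) \<omega> = u) = pmf (\<beta> (Suc t) s') a'"

definition visits :: "(nat \<Rightarrow> 'w \<Rightarrow> 's) \<Rightarrow> (nat \<Rightarrow> 'w \<Rightarrow> 'a) \<Rightarrow> 's \<Rightarrow> 'a \<Rightarrow> 'w \<Rightarrow> nat set" where
  "visits S A s a \<omega> = {t. S t \<omega> = s \<and> A t \<omega> = a}"

(* The iterates along one sample path: lr t h s a are the realised learning rates, st, ac and au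
   the realised states, actions and auxiliary actions. *)
primrec fhtd ::
  "('s \<Rightarrow> 'a \<Rightarrow> 's \<Rightarrow> real) \<Rightarrow> real \<Rightarrow> (nat \<Rightarrow> 's \<Rightarrow> 'a \<Rightarrow> real) \<Rightarrow>
    (nat \<Rightarrow> nat \<Rightarrow> 's \<Rightarrow> 'a \<Rightarrow> real) \<Rightarrow> (nat \<Rightarrow> 's) \<Rightarrow> (nat \<Rightarrow> 'a) \<Rightarrow> (nat \<Rightarrow> 'a) \<Rightarrow>
    nat \<Rightarrow> nat \<Rightarrow> 's \<Rightarrow> 'a \<Rightarrow> real" where
  "fhtd r \<gamma> Q0 lr st ac au 0 = (\<lambda>h s a. if h = 0 then 0 else Q0 h s a)"
| "fhtd r \<gamma> Q0 lr st ac au (Suc t) = (\<lambda>h s a.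
     let Q = fhtd r \<gamma> Q0 lr st ac au t in
     if h = 0 then 0
     else if s = st t \<and> a = ac t then
       Q h s a + lr t h s a *
         (r (st t) (ac t) (st (Suc t)) + \<gamma> * Q (h - 1) (st (Suc t)) (au (Suc t)) - Q h s a)
     else Q h s a)"

end

theory Submission
  imports Defs
begin

text \<open>
  Write \<open>c t\<close> for the learning rate at time \<open>t\<close> if \<open>(s, a)\<close> is visited then, and \<open>0\<close> otherwise.
  By induction on the horizon, the error of the \<open>h\<close>-step iterate at \<open>(s, a)\<close> obeys
  \<open>y (t + 1) = y t + c t * (w t + b t - y t)\<close>. The bias \<open>b t\<close> comes from the error at horizon
  \<open>h - 1\<close> and tends to \<open>0\<close>. The noise \<open>w t\<close> is taken relative to the exact value function of
  horizon \<open>h - 1\<close> instead of the iterate, which makes it a bounded martingale difference by the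
  Bellman recursion. Since the squares of the predictable weights \<open>c t\<close> are almost surely summable,
  \<open>\<Sum>t. c t * w t\<close> converges almost surely, and a pathwise argument then gives \<open>y t \<longlonglongrightarrow> 0\<close>.
\<close>

section \<open>Averaging with vanishing bias\<close>

text \<open>Once \<open>a t < 1\<close> and \<open>\<bar>b t\<bar> < d\<close>, the new iterate is a
  convex combination of the old one and a small number, so the excess of
  \<open>\<bar>y t\<bar>\<close> over \<open>d\<close> shrinks by the factor \<open>1 - a t\<close>.
  Divergence of the weights then drives the excess below \<open>d\<close>, where it stays.\<close>

lemma averaging_tendsto_0:
  fixes a b y :: "nat \<Rightarrow> real"
  assumes nonneg: "\<And>t. 0 \<le> a t"
    and a_lim: "a \<longlonglongrightarrow> 0"
    and div: "\<not> summable a"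
    and b: "b \<longlonglongrightarrow> 0"
    and step: "\<And>t. y (Suc t) = y t + a t * (b t - y t)"
  shows "y \<longlonglongrightarrow> 0"
proof (rule LIMSEQ_I)
  fix e :: real
  assume "e > 0"
  \<comment> \<open>One half bounds the bias and the other half the remaining excess.\<close>
  define d where "d = e / 2"
  have d: "d > 0" using \<open>e > 0\<close> by (simp add: d_def)
  have "\<forall>\<^sub>F t in sequentially. a t < 1" 
    using a_lim by (rule order_tendstoD) simp
  moreover have "\<forall>\<^sub>F t in sequentially. norm (b t) < d"
    using tendsto_norm[OF b] d by (auto intro: order_tendstoD)
  ultimately have "\<forall>\<^sub>F t in sequentially. a t < 1 \<and> norm (b t) < d"
    by (rule eventually_conj)
  then obtain N where N: "\<And>t. t \<ge> N \<Longrightarrow> a t < 1 \<and> \<bar>b t\<bar> < d"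
    by (auto simp: eventually_sequentially)
  have contr: "\<bar>y (Suc t)\<bar> - d \<le> (1 - a t) * (\<bar>y t\<bar> - d)" if "t \<ge> N" for t
  proof -
    have "\<bar>y (Suc t)\<bar> = \<bar>(1 - a t) * y t + a t * b t\<bar>"
      by (simp add: step algebra_simps)
    also have "\<dots> \<le> (1 - a t) * \<bar>y t\<bar> + a t * \<bar>b t\<bar>"
      using nonneg[of t] N[OF that] by (intro order_trans[OF abs_triangle_ineq]) (simp add: abs_mult)
    also have "\<dots> \<le> (1 - a t) * \<bar>y t\<bar> + a t * d"
      using nonneg[of t] N[OF that] by (intro add_left_mono mult_left_mono) auto
    finally show ?thesis by (simp add: algebra_simps)
  qed
  have "\<exists>T\<ge>N. \<bar>y T\<bar> - d < d"
  proof (rule ccontr)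
    assume "\<not> ?thesis"
    then have large: "\<bar>y t\<bar> - d \<ge> d" if "t \<ge> N" for t
      using that by (force simp: not_less)
    \<comment> \<open>While the excess is at least \<open>d\<close>, step \<open>t\<close> lowers it
      by at least \<open>a t * d\<close>. As it remains positive, the total weight is bounded,
      against divergence.\<close>
    have "(\<Sum>i<n. a (i + N)) * d \<le> (\<bar>y N\<bar> - d) - (\<bar>y (n + N)\<bar> - d)" for n
    proof (induction n)
      case (Suc n)
      have "\<bar>y (Suc n + N)\<bar> - d \<le> (\<bar>y (n + N)\<bar> - d) - a (n + N) * (\<bar>y (n + N)\<bar> - d)"
        using contr[of "n + N"] by (simp add: algebra_simps)
      moreover have "a (n + N) * d \<le> a (n + N) * (\<bar>y (n + N)\<bar> - d)"
        using large[of "n + N"] nonneg by (intro mult_left_mono) auto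
      ultimately show ?case using Suc by (simp add: algebra_simps)
    qed simp
    then have "(\<Sum>i<n. a (i + N)) \<le> (\<bar>y N\<bar> - d) / d" for n
      using large[of "n + N"] d by (simp add: pos_le_divide_eq) (smt (verit, best) le_add2)
    then have "summable (\<lambda>i. a (i + N))"
      by (intro summableI_nonneg_bounded) (auto simp: nonneg)
    with div show False by simp
  qed
  then obtain T where T: "T \<ge> N" "\<bar>y T\<bar> - d < d" by blast
  have "\<bar>y t\<bar> - d < d" if "t \<ge> T" for t
    using that
  proof (induction t rule: dec_induct)
    case base
    show ?case by (rule T)
  next
    case (step t)
    have at: "0 \<le> a t" "a t < 1" using nonneg N[of t] step T by auto
    have "\<bar>y (Suc t)\<bar> - d \<le> (1 - a t) * (\<bar>y t\<bar> - d)"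
      using contr step T by auto
    also have "\<dots> < (1 - a t) * d"
      using step at by (intro mult_strict_left_mono) auto
    also have "\<dots> \<le> d" using at d by (simp add: algebra_simps)
    finally show ?case .
  qed
  then show "\<exists>T. \<forall>t\<ge>T. norm (y t - 0) < e"
    by (intro exI[of _ T]) (force simp: d_def)
qed

text \<open>Adding the tail \<open>\<Sum>k\<ge>t. a k * w k\<close> to the iterate turns convergent noise into vanishing bias.\<close>
lemma noisy_averaging_tendsto_0:
  fixes a b w y :: "nat \<Rightarrow> real"
  assumes nonneg: "\<And>t. 0 \<le> a t"
    and a_lim: "a \<longlonglongrightarrow> 0"
    and div: "\<not> summable a"
    and b: "b \<longlonglongrightarrow> 0"
    and noise: "summable (\<lambda>t. a t * w t)"
    and step: "\<And>t. y (Suc t) = y t + a t * (w t + b t - y t)"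
  shows "y \<longlonglongrightarrow> 0"
proof -
  define R where "R t = (\<Sum>k. a (k + t) * w (k + t))" for t
  have R_lim: "R \<longlonglongrightarrow> 0"
    unfolding R_def by (rule suminf_exist_split2[OF noise])
  have R_Suc: "R t = a t * w t + R (Suc t)" for t
    using suminf_split_head[of "\<lambda>k. a (k + t) * w (k + t)"] noise
    by (simp add: R_def summable_iff_shift[of "\<lambda>k. a k * w k"])
  have "(\<lambda>t. y t + R t) \<longlonglongrightarrow> 0"
  proof (rule averaging_tendsto_0[OF nonneg a_lim div])
    \<comment> \<open>Passing from \<open>R t\<close> to \<open>R (Suc t)\<close> cancels the noise.
      The relaxation term now subtracts \<open>y t + R t\<close> instead of \<open>y t\<close>, so
      \<open>R t\<close> reappears in the bias.\<close>
    show "(\<lambda>t. b t + R t) \<longlonglongrightarrow> 0"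
      using tendsto_add[OF b R_lim] by simp
    show "y (Suc t) + R (Suc t) = y t + R t + a t * (b t + R t - (y t + R t))" for t
      using R_Suc[of t] by (simp add: step algebra_simps)
  qed
  from tendsto_diff[OF this R_lim] show ?thesis by simp
qed

section \<open>Weighted sums of martingale differences\<close>

lemma abs_mult_le: "\<bar>a\<bar> \<le> K \<Longrightarrow> \<bar>b\<bar> \<le> L \<Longrightarrow> \<bar>a * b\<bar> \<le> K * L" for a b :: real
  unfolding abs_mult by (intro mult_mono) auto

text \<open>\<open>D t\<close> is revealed only at time \<open>Suc t\<close>, so a weight measurable
  at time \<open>t\<close> is predictable. The bound holds at every point, which reduces
  integrability to measurability.\<close>

locale bounded_martingale_differences = prob_space M
  for M :: "'w measure"
    and F :: "nat \<Rightarrow> 'w measure"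
    and D :: "nat \<Rightarrow> 'w \<Rightarrow> real"
    and B :: real +
  assumes subalg: "\<And>t. subalgebra M (F t)"
    and filtration_mono: "\<And>t. subalgebra (F (Suc t)) (F t)"
    and D_measurable: "\<And>t. D t \<in> borel_measurable (F (Suc t))"
    and D_bounded: "\<And>t x. \<bar>D t x\<bar> \<le> B"
    and D_cond_exp: "\<And>t. AE x in M. real_cond_exp M (F t) (D t) x = 0"
begin

lemma filtration_le: "i \<le> j \<Longrightarrow> subalgebra (F j) (F i)"
  by (induction j rule: dec_induct) (use filtration_mono in \<open>force simp: subalgebra_def\<close>)+

lemma measurable_filtration_le:
  "i \<le> j \<Longrightarrow> f \<in> measurable (F i) N \<Longrightarrow> f \<in> measurable (F j) N"
  by (rule measurable_from_subalg[OF filtration_le])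

lemma measurable_filtration: "f \<in> measurable (F i) N \<Longrightarrow> f \<in> measurable M N"
  by (rule measurable_from_subalg[OF subalg])

lemma D_measurable_le: "i < t \<Longrightarrow> D i \<in> borel_measurable (F t)"
  using D_measurable[of i] by (rule measurable_filtration_le[rotated]) simp

lemma D_measurable_M [measurable]: "D t \<in> borel_measurable M"
  using D_measurable by (rule measurable_filtration)

lemma B_nonneg: "0 \<le> B"
  using D_bounded[of 0 undefined] by linarith

lemma D_square_le: "(D t x)\<^sup>2 \<le> B\<^sup>2"
  using D_bounded[of t x] B_nonneg by (simp add: abs_le_square_iff[symmetric])

lemma integrable_bounded:
  assumes "f \<in> borel_measurable M" "\<And>x. \<bar>f x\<bar> \<le> K"
  shows "integrable M (f :: 'w \<Rightarrow> real)"
  using assms by (intro integrable_const_bound[where B = K]) auto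

lemma integrable_square_bounded:
  assumes "f \<in> borel_measurable M" "\<And>x. \<bar>f x\<bar> \<le> K"
  shows "integrable M (\<lambda>x. (f x :: real)\<^sup>2)"
proof (rule integrable_bounded)
  show "\<bar>(f x)\<^sup>2\<bar> \<le> K\<^sup>2" for x
    using power_mono[OF assms(2)[of x], of 2] by simp
qed (use assms in measurable)

text \<open>A weight known at time \<open>t\<close> can be pulled out of the conditional expectation
  of \<open>D t\<close>, which vanishes.\<close>

lemma weight_D_expectation:
  assumes c: "c \<in> borel_measurable (F t)" and bound: "\<And>x. \<bar>c x\<bar> \<le> K"
  shows "expectation (\<lambda>x. c x * D t x) = 0"
proof -
  interpret finite_measure_subalgebra M "F t"
    by unfold_locales (rule subalg)
  have [measurable]: "c \<in> borel_measurable M"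
    using c by (rule measurable_filtration)
  have "integrable M (\<lambda>x. c x * D t x)"
    by (rule integrable_bounded[OF _ abs_mult_le[OF bound D_bounded]]) measurable
  from real_cond_exp_intg(2)[OF this c]
  have "expectation (\<lambda>x. c x * D t x) = expectation (\<lambda>x. c x * real_cond_exp M (F t) (D t) x)"
    by simp
  also have "\<dots> = expectation (\<lambda>x. 0)"
    using D_cond_exp[of t] by (intro integral_cong_AE) auto
  finally show ?thesis by simp
qed

lemma weighted_sum_measurable:
  assumes "\<And>t. c t \<in> borel_measurable (F t)" "k \<le> n"
  shows "(\<lambda>x. \<Sum>t<k. c t x * D t x) \<in> borel_measurable (F n)"
  using assms
  by (intro borel_measurable_sum borel_measurable_times)
    (auto intro: measurable_filtration_le[of i n for i, OF _ assms(1)] D_measurable_le)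

text \<open>Martingale differences are orthogonal: an earlier partial sum times \<open>c n\<close>
  is itself a bounded predictable weight. Only the diagonal terms survive, and the pathwise bound on
  the squared weights controls them.\<close>

lemma weighted_sum_second_moment:
  assumes c: "\<And>t. c t \<in> borel_measurable (F t)"
    and bound: "\<And>n x. (\<Sum>t<n. (c t x)\<^sup>2) \<le> \<delta>"
  shows "expectation (\<lambda>x. (\<Sum>t<n. c t x * D t x)\<^sup>2) \<le> B\<^sup>2 * \<delta>"
    and "integrable M (\<lambda>x. (\<Sum>t<n. c t x * D t x)\<^sup>2)"
proof -
  have cM [measurable]: "c t \<in> borel_measurable M" for t
    using c by (rule measurable_filtration)
  have "(c t x)\<^sup>2 \<le> \<delta>" for t x
    using bound[of x "Suc t"] sum_nonneg[of "{..<t}" "\<lambda>i. (c i x)\<^sup>2"] by simp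
  then have c_le: "\<bar>c t x\<bar> \<le> sqrt \<delta>" for t x
    by (simp add: real_le_rsqrt)
  have cD_le: "\<bar>c t x * D t x\<bar> \<le> sqrt \<delta> * B" for t x
    by (intro abs_mult_le c_le D_bounded)
  \<comment> \<open>This bound grows with \<open>k\<close>, but it only serves
    integrability.\<close>
  have sum_le: "\<bar>\<Sum>t<k. c t x * D t x\<bar> \<le> real k * (sqrt \<delta> * B)" for k x
    using sum_bounded_above[of "{..<k}" "\<lambda>t. \<bar>c t x * D t x\<bar>"] cD_le
    by (intro order_trans[OF sum_abs]) auto
  have int_sq: "integrable M (\<lambda>x. (\<Sum>t<k. c t x * D t x)\<^sup>2)" for k
    by (rule integrable_square_bounded[OF _ sum_le]) measurable
  then show "integrable M (\<lambda>x. (\<Sum>t<n. c t x * D t x)\<^sup>2)" .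
  have int_cD: "integrable M (\<lambda>x. (c t x * D t x)\<^sup>2)" for t
    using cD_le[of t] by (intro integrable_square_bounded) auto
  have orth: "expectation (\<lambda>x. (\<Sum>t<n. c t x * D t x)\<^sup>2) = expectation (\<lambda>x. \<Sum>t<n. (c t x * D t x)\<^sup>2)"
    for n
  proof (induction n)
    case (Suc n)
    let ?Z = "\<lambda>x. \<Sum>t<n. c t x * D t x"
    have cross_le: "\<bar>2 * ?Z x * c n x\<bar> \<le> 2 * (real n * (sqrt \<delta> * B)) * sqrt \<delta>" for x
      by (intro abs_mult_le sum_le c_le) simp
    have cross_meas: "(\<lambda>x. 2 * ?Z x * c n x) \<in> borel_measurable (F n)"
      by (intro borel_measurable_times weighted_sum_measurable c) auto
    have int_cross: "integrable M (\<lambda>x. 2 * ?Z x * c n x * D n x)"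
      by (rule integrable_bounded[OF _ abs_mult_le[OF cross_le D_bounded]]) measurable
    have "expectation (\<lambda>x. (\<Sum>t<Suc n. c t x * D t x)\<^sup>2)
        = expectation (\<lambda>x. ((?Z x)\<^sup>2 + (c n x * D n x)\<^sup>2) + 2 * ?Z x * c n x * D n x)"
      by (intro Bochner_Integration.integral_cong) (auto simp: power2_eq_square algebra_simps)
    also have "\<dots> = expectation (\<lambda>x. (?Z x)\<^sup>2) + expectation (\<lambda>x. (c n x * D n x)\<^sup>2)"
      using int_sq int_cD int_cross weight_D_expectation[OF cross_meas cross_le] by simp
    also have "\<dots> = expectation (\<lambda>x. \<Sum>t<Suc n. (c t x * D t x)\<^sup>2)"
      using int_cD by (simp add: Suc.IH)
    finally show ?case .
  qed simp
  have "(\<Sum>t<n. (c t x * D t x)\<^sup>2) \<le> B\<^sup>2 * \<delta>" for x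
  proof -
    have "(\<Sum>t<n. (c t x * D t x)\<^sup>2) \<le> (\<Sum>t<n. (c t x)\<^sup>2 * B\<^sup>2)"
      by (intro sum_mono) (auto simp: power_mult_distrib intro!: mult_left_mono D_square_le)
    also have "\<dots> = B\<^sup>2 * (\<Sum>t<n. (c t x)\<^sup>2)"
      by (simp add: sum_distrib_left mult.commute)
    also have "\<dots> \<le> B\<^sup>2 * \<delta>"
      using bound by (intro mult_left_mono) auto
    finally show ?thesis .
  qed
  then have "expectation (\<lambda>x. \<Sum>t<n. (c t x * D t x)\<^sup>2) \<le> expectation (\<lambda>x. B\<^sup>2 * \<delta>)"
    using int_cD by (intro integral_mono) auto
  then show "expectation (\<lambda>x. (\<Sum>t<n. c t x * D t x)\<^sup>2) \<le> B\<^sup>2 * \<delta>"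
    by (simp add: orth prob_space)
qed

text \<open>Setting the weights to zero once the partial sum has left \<open>(-\<epsilon>, \<epsilon>)\<close> keeps them predictable and
  freezes the sum outside, so Chebyshev's inequality at time \<open>n\<close> controls all earlier times.\<close>
lemma weighted_sum_maximal_finite:
  assumes c: "\<And>t. c t \<in> borel_measurable (F t)"
    and bound: "\<And>n x. (\<Sum>t<n. (c t x)\<^sup>2) \<le> \<delta>"
    and \<epsilon>: "\<epsilon> > 0"
  shows "prob {x \<in> space M. \<exists>k\<le>n. \<bar>\<Sum>t<k. c t x * D t x\<bar> \<ge> \<epsilon>} \<le> B\<^sup>2 * \<delta> / \<epsilon>\<^sup>2"
proof -
  define Z where "Z k x = (\<Sum>t<k. c t x * D t x)" for k x
  \<comment> \<open>\<open>Z k\<close> with \<open>k \<le> t\<close> involves \<open>D\<close> only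
    at times before \<open>t\<close>, so the stopping condition is known at time
    \<open>t\<close>.\<close>
  define c' where "c' t x = (if \<forall>k\<in>{..t}. \<bar>Z k x\<bar> < \<epsilon> then c t x else 0)" for t x
  have Z_meas: "Z k \<in> borel_measurable (F t)" if "k \<le> t" for k t
    unfolding Z_def using that c by (intro weighted_sum_measurable)
  have c'_meas: "c' t \<in> borel_measurable (F t)" for t
  proof -
    have "Measurable.pred (F t) (\<lambda>x. \<bar>Z k x\<bar> < \<epsilon>)" if "k \<in> {..t}" for k
    proof -
      have [measurable]: "Z k \<in> borel_measurable (F t)" using that Z_meas by auto
      show ?thesis by measurable
    qed
    then have [measurable]: "Measurable.pred (F t) (\<lambda>x. \<forall>k\<in>{..t}. \<bar>Z k x\<bar> < \<epsilon>)"
      by (intro pred_intros_finite) auto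
    have [measurable]: "c t \<in> borel_measurable (F t)" by (rule c)
    show ?thesis unfolding c'_def by measurable
  qed
  have c'_bound: "(\<Sum>t<n. (c' t x)\<^sup>2) \<le> \<delta>" for n x
    by (rule order_trans[OF sum_mono bound[of x n]]) (auto simp: c'_def)
  let ?Z' = "\<lambda>x. \<Sum>t<n. c' t x * D t x"
  have Z'_meas [measurable]: "?Z' \<in> borel_measurable M"
    by (rule measurable_filtration[of _ n], rule weighted_sum_measurable) (auto simp: c'_meas)
  have "{x \<in> space M. \<exists>k\<le>n. \<bar>Z k x\<bar> \<ge> \<epsilon>} \<subseteq> {x \<in> space M. \<epsilon> \<le> \<bar>?Z' x\<bar>}"
  proof safe
    fix x k
    assume k: "k \<le> n" "\<bar>Z k x\<bar> \<ge> \<epsilon>"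
    \<comment> \<open>At the first exit time \<open>K\<close> the weights with index below
      \<open>K\<close> are intact and all later ones vanish, so the stopped sum stays at
      \<open>Z K x\<close>.\<close>
    define K where "K = (LEAST k. \<bar>Z k x\<bar> \<ge> \<epsilon>)"
    have K: "\<bar>Z K x\<bar> \<ge> \<epsilon>" unfolding K_def by (rule LeastI, rule k)
    have "K \<le> n" using Least_le[of "\<lambda>k. \<bar>Z k x\<bar> \<ge> \<epsilon>" k] k by (auto simp: K_def)
    have less: "\<bar>Z j x\<bar> < \<epsilon>" if "j < K" for j
      using not_less_Least[of j "\<lambda>k. \<bar>Z k x\<bar> \<ge> \<epsilon>"] that by (auto simp: K_def)
    have c'_eq: "c' t x = (if t < K then c t x else 0)" for t
      using K less by (force simp: c'_def not_less)
    have "?Z' x = Z K x"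
      unfolding Z_def using \<open>K \<le> n\<close> by (intro sum.mono_neutral_cong_right) (auto simp: c'_eq)
    then show "\<epsilon> \<le> \<bar>?Z' x\<bar>" using K by simp
  qed
  then have "prob {x \<in> space M. \<exists>k\<le>n. \<bar>Z k x\<bar> \<ge> \<epsilon>} \<le> prob {x \<in> space M. \<epsilon> \<le> \<bar>?Z' x\<bar>}"
    by (intro finite_measure_mono) auto
  also have "\<dots> \<le> expectation (\<lambda>x. (?Z' x)\<^sup>2) / \<epsilon>\<^sup>2"
    by (intro second_moment_method weighted_sum_second_moment(2)[OF c'_meas c'_bound] \<epsilon>) simp
  also have "\<dots> \<le> B\<^sup>2 * \<delta> / \<epsilon>\<^sup>2"
    by (intro divide_right_mono weighted_sum_second_moment(1)[OF c'_meas c'_bound]) simp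
  finally show ?thesis unfolding Z_def .
qed

text \<open>The finite-time bound does not depend on \<open>n\<close>, and the events increase with
  \<open>n\<close>, so continuity from below applies.\<close>

lemma weighted_sum_maximal:
  assumes c: "\<And>t. c t \<in> borel_measurable (F t)"
    and bound: "\<And>n x. (\<Sum>t<n. (c t x)\<^sup>2) \<le> \<delta>"
    and \<epsilon>: "\<epsilon> > 0"
  shows "prob {x \<in> space M. \<exists>k. \<bar>\<Sum>t<k. c t x * D t x\<bar> \<ge> \<epsilon>} \<le> B\<^sup>2 * \<delta> / \<epsilon>\<^sup>2"
proof -
  have [measurable]: "c t \<in> borel_measurable M" for t
    using c by (rule measurable_filtration)
  define X where "X n = {x \<in> space M. \<exists>k\<le>n. \<bar>\<Sum>t<k. c t x * D t x\<bar> \<ge> \<epsilon>}" for n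
  have "(\<lambda>n. prob (X n)) \<longlonglongrightarrow> prob (\<Union>n. X n)"
    by (rule finite_Lim_measure_incseq) (auto simp: X_def incseq_def intro: order_trans)
  then have "prob (\<Union>n. X n) \<le> B\<^sup>2 * \<delta> / \<epsilon>\<^sup>2"
    by (rule LIMSEQ_le_const2)
      (auto simp: X_def intro!: weighted_sum_maximal_finite[OF c bound \<epsilon>])
  also have "(\<Union>n. X n) = {x \<in> space M. \<exists>k. \<bar>\<Sum>t<k. c t x * D t x\<bar> \<ge> \<epsilon>}"
    by (auto simp: X_def)
  finally show ?thesis .
qed

text \<open>Cutting the weights off once their squares from time \<open>m\<close> on exceed \<open>\<delta>\<close> makes the maximal inequality
  applicable; as \<open>m\<close> grows, the cutoff becomes inactive almost surely, and \<open>\<delta>\<close> is arbitrary.\<close>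
lemma oscillation_null:
  assumes c: "\<And>t. c t \<in> borel_measurable (F t)"
    and sq: "AE x in M. summable (\<lambda>t. (c t x)\<^sup>2)"
    and \<epsilon>: "\<epsilon> > 0"
  shows "AE x in M. \<exists>m. \<forall>k. \<bar>\<Sum>t=m..<k. c t x * D t x\<bar> < \<epsilon>"
proof -
  have [measurable]: "c t \<in> borel_measurable M" for t
    using c by (rule measurable_filtration)
  define E where "E = {x \<in> space M. \<forall>m. \<exists>k. \<bar>\<Sum>t=m..<k. c t x * D t x\<bar> \<ge> \<epsilon>}"
  have E [measurable]: "E \<in> sets M" unfolding E_def by measurable
  have E_le: "prob E \<le> B\<^sup>2 * \<delta> / \<epsilon>\<^sup>2" if \<delta>: "\<delta> > 0" for \<delta>
  proof -
    \<comment> \<open>On \<open>X m\<close> the cutoff after time \<open>m\<close> never acts. These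
      events increase with \<open>m\<close> and, by summability of the squares, cover almost every
      point.\<close>
    define X where "X m = {x \<in> space M. \<forall>n. (\<Sum>t=m..<n. (c t x)\<^sup>2) \<le> \<delta>}" for m
    have X [measurable]: "X m \<in> sets M" for m unfolding X_def by measurable
    have "incseq (\<lambda>m. E \<inter> X m)"
    proof (rule incseq_SucI, safe)
      fix m x assume x: "x \<in> X m"
      have "(\<Sum>t=Suc m..<n. (c t x)\<^sup>2) \<le> (\<Sum>t=m..<n. (c t x)\<^sup>2)" for n
        by (intro sum_mono2) auto
      with x show "x \<in> X (Suc m)" unfolding X_def using order_trans by blast
    qed
    then have lim: "(\<lambda>m. prob (E \<inter> X m)) \<longlonglongrightarrow> prob (\<Union>m. E \<inter> X m)"
      by (intro finite_Lim_measure_incseq) auto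
    have "prob (E \<inter> X m) \<le> B\<^sup>2 * \<delta> / \<epsilon>\<^sup>2" for m
    proof -
      \<comment> \<open>The tested sum includes the index \<open>t\<close> itself, which is allowed
        because \<open>c t\<close> is predictable, and prevents an overshoot beyond
        \<open>\<delta>\<close>.\<close>
      define c' where "c' t x = (if m \<le> t \<and> (\<Sum>i=m..t. (c i x)\<^sup>2) \<le> \<delta> then c t x else 0)" for t x
      have c'_meas: "c' t \<in> borel_measurable (F t)" for t
      proof -
        have [measurable]: "(\<lambda>x. \<Sum>i=m..t. (c i x)\<^sup>2) \<in> borel_measurable (F t)"
          by (intro borel_measurable_sum borel_measurable_power)
            (auto intro: measurable_filtration_le[OF _ c])
        have [measurable]: "c t \<in> borel_measurable (F t)" by (rule c)
        show ?thesis unfolding c'_def by measurable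
      qed
      have c'_bound: "(\<Sum>t<n. (c' t x)\<^sup>2) \<le> \<delta>" for n x
      proof -
        \<comment> \<open>All active times lie between \<open>m\<close> and the last active one,
          where the cutoff condition bounds the whole sum.\<close>
        define I where "I = {t. t < n \<and> m \<le> t \<and> (\<Sum>i=m..t. (c i x)\<^sup>2) \<le> \<delta>}"
        have "finite I" by (simp add: I_def)
        have eq: "(\<Sum>t<n. (c' t x)\<^sup>2) = (\<Sum>t\<in>I. (c t x)\<^sup>2)"
          by (rule sum.mono_neutral_cong_right) (auto simp: I_def c'_def)
        show ?thesis
        proof (cases "I = {}")
          case False
          then have Max: "Max I \<in> I" using \<open>finite I\<close> by simp
          have "(\<Sum>t\<in>I. (c t x)\<^sup>2) \<le> (\<Sum>i=m..Max I. (c i x)\<^sup>2)"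
            using \<open>finite I\<close> by (intro sum_mono2) (auto simp: I_def intro: Max_ge)
          also have "\<dots> \<le> \<delta>" using Max by (simp add: I_def)
          finally show ?thesis by (simp add: eq)
        qed (use \<delta> eq in simp)
      qed
      have [measurable]: "c' t \<in> borel_measurable M" for t
        using c'_meas by (rule measurable_filtration)
      have "E \<inter> X m \<subseteq> {x \<in> space M. \<exists>k. \<bar>\<Sum>t<k. c' t x * D t x\<bar> \<ge> \<epsilon>}"
      proof safe
        fix x assume x: "x \<in> E" "x \<in> X m"
        then show "x \<in> space M" by (simp add: X_def)
        from x obtain k where k: "\<bar>\<Sum>t=m..<k. c t x * D t x\<bar> \<ge> \<epsilon>" by (auto simp: E_def)
        have "(\<Sum>i=m..t. (c i x)\<^sup>2) \<le> \<delta>" for t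
          using x(2) unfolding X_def atLeastLessThanSuc_atLeastAtMost[symmetric] by blast
        then have "c' t x = (if m \<le> t then c t x else 0)" for t
          by (simp add: c'_def)
        then have "(\<Sum>t<k. c' t x * D t x) = (\<Sum>t=m..<k. c t x * D t x)"
          by (intro sum.mono_neutral_cong_right) auto
        with k show "\<exists>k. \<bar>\<Sum>t<k. c' t x * D t x\<bar> \<ge> \<epsilon>" by metis
      qed
      then have "prob (E \<inter> X m) \<le> prob {x \<in> space M. \<exists>k. \<bar>\<Sum>t<k. c' t x * D t x\<bar> \<ge> \<epsilon>}"
        by (intro finite_measure_mono) auto
      also have "\<dots> \<le> B\<^sup>2 * \<delta> / \<epsilon>\<^sup>2"
        by (rule weighted_sum_maximal[OF c'_meas c'_bound \<epsilon>])
      finally show ?thesis .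
    qed
    with lim have "prob (\<Union>m. E \<inter> X m) \<le> B\<^sup>2 * \<delta> / \<epsilon>\<^sup>2"
      by (intro LIMSEQ_le_const2) auto
    moreover have "prob (\<Union>m. E \<inter> X m) = prob E"
    proof (rule finite_measure_eq_AE)
      show "AE x in M. x \<in> (\<Union>m. E \<inter> X m) \<longleftrightarrow> x \<in> E"
        using sq
      proof eventually_elim
        case (elim x)
        then obtain m where "\<forall>n. \<bar>\<Sum>t=m..<n. (c t x)\<^sup>2\<bar> < \<delta>"
          unfolding summable_Cauchy using \<delta> by fastforce
        then have "\<forall>n. (\<Sum>t=m..<n. (c t x)\<^sup>2) \<le> \<delta>"
          by (meson abs_ge_self less_imp_le order_trans)
        then show ?case by (auto simp: X_def E_def)
      qed
    qed auto
    ultimately show ?thesis by simp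
  qed
  \<comment> \<open>The event \<open>E\<close> does not depend on \<open>\<delta>\<close>, so
    letting \<open>\<delta>\<close> tend to 0 shows that it is null.\<close>
  have "((\<lambda>\<delta>. B\<^sup>2 * \<delta> / \<epsilon>\<^sup>2) \<longlongrightarrow> B\<^sup>2 * 0 / \<epsilon>\<^sup>2) (at_right 0)"
    by (intro tendsto_intros) (use \<epsilon> in auto)
  then have "prob E \<le> B\<^sup>2 * 0 / \<epsilon>\<^sup>2"
    by (rule tendsto_lowerbound)
      (auto simp: eventually_at_right_field intro!: exI[of _ 1] E_le)
  then have "prob E = 0" using measure_nonneg[of M E] by simp
  then have "E \<in> null_sets M"
    by (auto simp: null_sets_def emeasure_eq_measure)
  then have "AE x in M. x \<notin> E" by (rule AE_not_in)
  with AE_space show ?thesis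
    by eventually_elim (auto simp: E_def not_le)
qed

text \<open>Countably many oscillation thresholds hold simultaneously almost surely, which gives the
  Cauchy criterion.\<close>

lemma AE_summable_weighted:
  assumes c: "\<And>t. c t \<in> borel_measurable (F t)"
    and sq: "AE x in M. summable (\<lambda>t. (c t x)\<^sup>2)"
  shows "AE x in M. summable (\<lambda>t. c t x * D t x)"
proof -
  have "AE x in M. \<forall>j. \<exists>m. \<forall>k. \<bar>\<Sum>t=m..<k. c t x * D t x\<bar> < 1 / Suc j"
    unfolding AE_all_countable by (intro allI oscillation_null[OF c sq]) simp
  then show ?thesis
  proof eventually_elim
    case (elim x)
    let ?f = "\<lambda>t. c t x * D t x"
    show ?case unfolding summable_Cauchy
    proof (intro allI impI)
      fix e :: real assume "e > 0"
      \<comment> \<open>A block from \<open>i\<close> to \<open>n\<close> is a difference of two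
        blocks that start at \<open>m\<close>, so each may contribute half of
        \<open>e\<close>.\<close>
      then obtain j where j: "1 / Suc j < e / 2"
        using nat_approx_posE[of "e / 2"] by auto
      from elim obtain m where m: "\<And>k. \<bar>sum ?f {m..<k}\<bar> < 1 / Suc j" by blast
      have "norm (sum ?f {i..<n}) < e" if "i \<ge> m" for i n
      proof (cases "i \<le> n")
        case True
        then have "sum ?f {i..<n} = sum ?f {m..<n} - sum ?f {m..<i}"
          using that by (simp add: sum_diff_nat_ivl)
        then show ?thesis using m[of i] m[of n] j by simp
      qed (use \<open>e > 0\<close> in simp)
      then show "\<exists>N. \<forall>i\<ge>N. \<forall>n. norm (sum ?f {i..<n}) < e" by blast
    qed
  qed
qed

end

section \<open>The Bellman recursion\<close>

lemma finite_set_rollout: "finite (set_pmf (rollout p \<pi> n s a))"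
  for p :: "'s::finite \<Rightarrow> 'a::finite \<Rightarrow> 's pmf"
  by (induction n arbitrary: s a) auto

lemma rollout_nth_0: "xs \<in> set_pmf (rollout p \<pi> n s a) \<Longrightarrow> xs ! 0 = (s, a)"
  by (cases n) auto

lemma Q_value_0: "Q_value p r \<gamma> \<pi> 0 s a = 0"
  by (simp add: Q_value_def)

text \<open>First-step analysis: split off the first reward and condition on the next state and
  action. Finite supports settle all integrability questions.\<close>

lemma Q_value_Suc:
  fixes p :: "'s::finite \<Rightarrow> 'a::finite \<Rightarrow> 's pmf"
  shows "Q_value p r \<gamma> \<pi> (Suc h) s a =
    (\<Sum>s'\<in>UNIV. \<Sum>a'\<in>UNIV. pmf (p s a) s' * pmf (\<pi> s') a' * (r s a s' + \<gamma> * Q_value p r \<gamma> \<pi> h s' a'))"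
proof -
  define G where "G h xs = (\<Sum>t<h. \<gamma> ^ t * r (fst (xs ! t)) (snd (xs ! t)) (fst (xs ! Suc t)))"
    for h and xs :: "('s \<times> 'a) list"
  have Q: "Q_value p r \<gamma> \<pi> h s a = measure_pmf.expectation (rollout p \<pi> h s a) (G h)" for h s a
    by (simp add: Q_value_def G_def[abs_def])
  have G_Cons: "G (Suc h) ((s, a) # xs) = r s a (fst (xs ! 0)) + \<gamma> * G h xs" for xs
    unfolding G_def sum.lessThan_Suc_shift sum_distrib_left by (simp add: mult.assoc)
  have int: "integrable (measure_pmf (rollout p \<pi> n s a)) f" for n s a and f :: "_ \<Rightarrow> real"
    by (intro integrable_measure_pmf_finite finite_set_rollout)
  have step: "measure_pmf.expectation (map_pmf ((#) (s, a)) (rollout p \<pi> h s' a')) (G (Suc h))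
      = r s a s' + \<gamma> * Q_value p r \<gamma> \<pi> h s' a'" for s' a'
  proof -
    have "measure_pmf.expectation (map_pmf ((#) (s, a)) (rollout p \<pi> h s' a')) (G (Suc h))
        = measure_pmf.expectation (rollout p \<pi> h s' a') (\<lambda>xs. r s a (fst (xs ! 0)) + \<gamma> * G h xs)"
      by (simp add: G_Cons)
    \<comment> \<open>Every rollout in the support begins with \<open>(s', a')\<close>, which fixes
      the first reward.\<close>
    also have "\<dots> = measure_pmf.expectation (rollout p \<pi> h s' a') (\<lambda>xs. r s a s' + \<gamma> * G h xs)"
      by (intro integral_cong_AE) (auto simp: AE_measure_pmf_iff dest: rollout_nth_0)
    also have "\<dots> = r s a s' + \<gamma> * Q_value p r \<gamma> \<pi> h s' a'"
      by (simp add: Q int measure_pmf.prob_space)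
    finally show ?thesis .
  qed
  have inner: "measure_pmf.expectation
        (bind_pmf (\<pi> s') (\<lambda>a'. map_pmf ((#) (s, a)) (rollout p \<pi> h s' a'))) (G (Suc h))
      = (\<Sum>a'\<in>UNIV. pmf (\<pi> s') a' * (r s a s' + \<gamma> * Q_value p r \<gamma> \<pi> h s' a'))" for s'
    by (subst pmf_expectation_bind[of UNIV]) (auto simp: finite_set_rollout step simp del: integral_map_pmf)
  have "Q_value p r \<gamma> \<pi> (Suc h) s a =
      (\<Sum>s'\<in>UNIV. pmf (p s a) s' * (\<Sum>a'\<in>UNIV. pmf (\<pi> s') a' * (r s a s' + \<gamma> * Q_value p r \<gamma> \<pi> h s' a')))"
    unfolding Q[of "Suc h"] rollout.simps
    by (subst pmf_expectation_bind[of UNIV]) (auto simp: finite_set_rollout inner)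
  also have "\<dots> = (\<Sum>s'\<in>UNIV. \<Sum>a'\<in>UNIV.
      pmf (p s a) s' * pmf (\<pi> s') a' * (r s a s' + \<gamma> * Q_value p r \<gamma> \<pi> h s' a'))"
    by (simp add: sum_distrib_left mult.assoc)
  finally show ?thesis .
qed

section \<open>The natural filtration of the behavioural process\<close>

lemma sum_pmf_UNIV: "(\<Sum>x\<in>UNIV. pmf q x) = 1" for q :: "'b::finite pmf"
  by (rule sum_pmf_eq_1) auto

lemma history_Suc:
  "history S A U (Suc t) \<omega> =
    (fst (history S A U t \<omega>) @ [(S (Suc t) \<omega>, A (Suc t) \<omega>)], snd (history S A U t \<omega>) @ [U (Suc t) \<omega>])"
  by (simp add: history_def)

lemma history_nth_state: "i \<le> t \<Longrightarrow> fst (history S A U t \<omega>) ! i = (S i \<omega>, A i \<omega>)"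
  by (simp add: history_def del: upt_Suc)

text \<open>The recorded auxiliary actions begin at time 1, hence the shift of the index.\<close>

lemma history_nth_aux: "i < t \<Longrightarrow> snd (history S A U t \<omega>) ! i = U (Suc i) \<omega>"
  by (simp add: history_def nth_append del: upt_Suc)

context behaviour_process
begin

text \<open>All components take values in countable types, so each can be frozen to a constant in
  turn.\<close>

lemma history_measurable [measurable]: "history S A U t \<in> measurable M (count_space UNIV)"
proof (induction t)
  case 0
  have "history S A U 0 = (\<lambda>\<omega>. ([(S 0 \<omega>, A 0 \<omega>)], []))"
    by (simp add: history_def fun_eq_iff)
  moreover have "(\<lambda>\<omega>. ([(S 0 \<omega>, A 0 \<omega>)], [] :: 'a list)) \<in> measurable M (count_space UNIV)"
    by (rule measurable_compose_countable[OF measurable_compose_countable[OF _ A_measurable] S_measurable]) simp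
  ultimately show ?case by simp
next
  case (Suc t)
  have "(\<lambda>\<omega>. (fst \<eta> @ [(s, a)], snd \<eta> @ [U (Suc t) \<omega>])) \<in> measurable M (count_space UNIV)"
    for \<eta> :: "('s, 'a) history" and s a
    by (rule measurable_compose_countable[OF _ U_measurable]) simp
  then have "(\<lambda>\<omega>. (fst \<eta> @ [(s, A (Suc t) \<omega>)], snd \<eta> @ [U (Suc t) \<omega>])) \<in> measurable M (count_space UNIV)"
    for \<eta> :: "('s, 'a) history" and s
    by (rule measurable_compose_countable[OF _ A_measurable])
  then have "(\<lambda>\<omega>. (fst \<eta> @ [(S (Suc t) \<omega>, A (Suc t) \<omega>)], snd \<eta> @ [U (Suc t) \<omega>])) \<in> measurable M (count_space UNIV)"
    for \<eta> :: "('s, 'a) history"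
    by (rule measurable_compose_countable[OF _ S_measurable])
  then have "(\<lambda>\<omega>. (\<lambda>\<eta> \<omega>. (fst \<eta> @ [(S (Suc t) \<omega>, A (Suc t) \<omega>)], snd \<eta> @ [U (Suc t) \<omega>]))
      (history S A U t \<omega>) \<omega>) \<in> measurable M (count_space UNIV)"
    by (rule measurable_compose_countable[OF _ Suc])
  also have "(\<lambda>\<omega>. (\<lambda>\<eta> \<omega>. (fst \<eta> @ [(S (Suc t) \<omega>, A (Suc t) \<omega>)], snd \<eta> @ [U (Suc t) \<omega>]))
      (history S A U t \<omega>) \<omega>) = history S A U (Suc t)"
    by (rule ext) (simp only: history_Suc)
  finally show ?case .
qed

definition filt :: "nat \<Rightarrow> 'w measure" where
  "filt t = vimage_algebra (space M) (history S A U t) (count_space UNIV)"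

lemma space_filt [simp]: "space (filt t) = space M"
  by (simp add: filt_def)

lemma sets_filt: "sets (filt t) = {history S A U t -` X \<inter> space M | X. True}"
  unfolding filt_def by (subst sets_vimage_algebra2) auto

lemma measurable_history_filt: "history S A U t \<in> measurable (filt t) (count_space UNIV)"
  unfolding filt_def by (rule measurable_vimage_algebra1) simp

text \<open>Histories carry the discrete sigma-algebra, so an arbitrary function of the history is
  measurable. This is what makes history-dependent learning rates predictable.\<close>

lemma measurable_filtI:
  assumes "\<And>\<omega>. f \<omega> = g (history S A U t \<omega>)" "\<And>\<eta>. g \<eta> \<in> space N"
  shows "f \<in> measurable (filt t) N"
proof -
  have "f = (\<lambda>\<omega>. g (history S A U t \<omega>))" using assms(1) by (rule ext)
  then show ?thesis
    using measurable_compose[OF measurable_history_filt, of g N] assms(2) by simp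
qed

lemma subalgebra_filt: "subalgebra M (filt t)"
  using measurable_sets[OF history_measurable[of t]] by (auto simp: subalgebra_def sets_filt)

lemma subalgebra_filt_Suc: "subalgebra (filt (Suc t)) (filt t)"
proof -
  have "history S A U t \<in> measurable (filt (Suc t)) (count_space UNIV)"
    by (rule measurable_filtI[where g = "\<lambda>\<eta>. (butlast (fst \<eta>), butlast (snd \<eta>))"])
      (auto simp: history_Suc)
  from measurable_sets[OF this] show ?thesis
    by (auto simp: subalgebra_def sets_filt[of t])
qed

text \<open>Chain rule for the conditional laws of the next state and the auxiliary action. If a
  conditioning event is null, those laws say nothing, but both sides are 0.\<close>

lemma prob_history_transition:
  assumes "last (fst \<eta>) = (s, a)" "fst \<eta> \<noteq> []"
  shows "\<P>(\<omega> in M. history S A U t \<omega> = \<eta> \<and> S (Suc t) \<omega> = s' \<and> U (Suc t) \<omega> = u)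
    = \<P>(\<omega> in M. history S A U t \<omega> = \<eta>) * pmf (p s a) s' * pmf (\<pi> s') u"
proof -
  note [measurable] = S_measurable U_measurable
  obtain xs us where \<eta>: "\<eta> = (xs @ [(s, a)], us)"
    using assms by (metis append_butlast_last_id prod.collapse)
  have state: "\<P>(\<omega> in M. history S A U t \<omega> = \<eta> \<and> S (Suc t) \<omega> = s')
      = \<P>(\<omega> in M. history S A U t \<omega> = \<eta>) * pmf (p s a) s'"
  proof (cases "\<P>(\<omega> in M. history S A U t \<omega> = \<eta>) = 0")
    case True
    have "\<P>(\<omega> in M. history S A U t \<omega> = \<eta> \<and> S (Suc t) \<omega> = s') \<le> \<P>(\<omega> in M. history S A U t \<omega> = \<eta>)"
      by (intro finite_measure_mono) auto
    with True show ?thesis using measure_nonneg[of M] by (simp add: antisym)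
  next
    case False
    then show ?thesis
      using next_state[of t xs s a us s'] by (simp add: \<eta> cond_prob_def field_simps conj_commute)
  qed
  show ?thesis
  proof (cases "\<P>(\<omega> in M. history S A U t \<omega> = \<eta> \<and> S (Suc t) \<omega> = s') = 0")
    case True
    have "\<P>(\<omega> in M. history S A U t \<omega> = \<eta> \<and> S (Suc t) \<omega> = s' \<and> U (Suc t) \<omega> = u)
        \<le> \<P>(\<omega> in M. history S A U t \<omega> = \<eta> \<and> S (Suc t) \<omega> = s')"
      by (intro finite_measure_mono) auto
    then have "\<P>(\<omega> in M. history S A U t \<omega> = \<eta> \<and> S (Suc t) \<omega> = s' \<and> U (Suc t) \<omega> = u) = 0"
      unfolding True by (intro antisym measure_nonneg)
    with True show ?thesis by (simp only: state[symmetric])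
  next
    case False
    then have "\<P>(\<omega> in M. history S A U t \<omega> = \<eta> \<and> S (Suc t) \<omega> = s' \<and> U (Suc t) \<omega> = u)
        = \<P>(\<omega> in M. history S A U t \<omega> = \<eta> \<and> S (Suc t) \<omega> = s') * pmf (\<pi> s') u"
      using auxiliary_action[of t \<eta> s' u] by (simp add: cond_prob_def field_simps conj_ac)
    then show ?thesis by (simp add: state)
  qed
qed

section \<open>Transitions as martingale differences\<close>

lemma finite_range_expectation:
  fixes f :: "'b \<Rightarrow> real"
  assumes [measurable]: "X \<in> measurable M (count_space UNIV)"
    and fin: "finite I" and range: "\<And>\<omega>. X \<omega> \<in> I"
  shows "expectation (\<lambda>\<omega>. f (X \<omega>)) = (\<Sum>x\<in>I. f x * \<P>(\<omega> in M. X \<omega> = x))"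
    and "integrable M (\<lambda>\<omega>. f (X \<omega>))"
proof -
  have eq: "f (X \<omega>) = (\<Sum>x\<in>I. f x * indicator {\<omega> \<in> space M. X \<omega> = x} \<omega>)" if "\<omega> \<in> space M" for \<omega>
  proof -
    have "(\<Sum>x\<in>I. f x * indicator {\<omega> \<in> space M. X \<omega> = x} \<omega>) = (\<Sum>x\<in>I. if x = X \<omega> then f x else 0)"
      using that by (intro sum.cong) (auto simp: indicator_def)
    with fin range show ?thesis by simp
  qed
  have int: "integrable M (\<lambda>\<omega>. f x * indicator {\<omega> \<in> space M. X \<omega> = x} \<omega>)" for x
    by (intro integrable_mult_right integrable_real_indicator) (auto simp: emeasure_eq_measure)
  show "integrable M (\<lambda>\<omega>. f (X \<omega>))"
    using int by (subst Bochner_Integration.integrable_cong[OF refl eq]) auto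
  have "expectation (\<lambda>\<omega>. f (X \<omega>)) = expectation (\<lambda>\<omega>. \<Sum>x\<in>I. f x * indicator {\<omega> \<in> space M. X \<omega> = x} \<omega>)"
    by (intro Bochner_Integration.integral_cong refl eq)
  also have "\<dots> = (\<Sum>x\<in>I. f x * \<P>(\<omega> in M. X \<omega> = x))"
    using int by simp
  finally show "expectation (\<lambda>\<omega>. f (X \<omega>)) = (\<Sum>x\<in>I. f x * \<P>(\<omega> in M. X \<omega> = x))" .
qed

text \<open>Setting the noise to 0 off the visits to \<open>(s, a)\<close> keeps the filtration
  indexed by ordinary time and avoids the random visit times.\<close>

definition transition_noise :: "('s \<Rightarrow> 'a \<Rightarrow> real) \<Rightarrow> 's \<Rightarrow> 'a \<Rightarrow> nat \<Rightarrow> 'w \<Rightarrow> real" where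
  "transition_noise g s a t \<omega> = (if S t \<omega> = s \<and> A t \<omega> = a then g (S (Suc t) \<omega>) (U (Suc t) \<omega>) else 0)"

lemma transition_noise_measurable: "transition_noise g s a t \<in> borel_measurable (filt (Suc t))"
proof (rule measurable_filtI)
  show "transition_noise g s a t \<omega> =
      (\<lambda>\<eta>. if fst \<eta> ! t = (s, a) then g (fst (fst \<eta> ! Suc t)) (snd \<eta> ! t) else 0)
        (history S A U (Suc t) \<omega>)" for \<omega>
    by (simp add: transition_noise_def history_nth_state history_nth_aux)
qed simp

text \<open>An event of \<open>filt t\<close> is a set of histories. On each history that ends in
  \<open>(s, a)\<close>, the transition law factors and averages \<open>g\<close> to 0.\<close>

lemma transition_noise_cond_exp:
  assumes mean: "(\<Sum>s'\<in>UNIV. \<Sum>u\<in>UNIV. pmf (p s a) s' * pmf (\<pi> s') u * g s' u) = 0"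
  shows "AE \<omega> in M. real_cond_exp M (filt t) (transition_noise g s a t) \<omega> = 0"
proof -
  note [measurable] = S_measurable U_measurable
  interpret finite_measure_subalgebra M "filt t"
    by unfold_locales (rule subalgebra_filt)
  define X where "X \<omega> = (history S A U t \<omega>, S (Suc t) \<omega>, U (Suc t) \<omega>)" for \<omega>
  \<comment> \<open>By time \<open>t\<close> there are \<open>Suc t\<close> state-action pairs and
    \<open>t\<close> auxiliary actions, so only finitely many histories are possible.\<close>
  define I where "I = {xs :: ('s \<times> 'a) list. length xs = Suc t} \<times> {us :: 'a list. length us = t}"
  have I: "finite I"
    unfolding I_def
    using finite_lists_length_eq[of "UNIV :: ('s \<times> 'a) set"] finite_lists_length_eq[of "UNIV :: 'a set"]
    by (intro finite_cartesian_product) auto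
  have X_meas: "X \<in> measurable M (count_space UNIV)"
    unfolding X_def by measurable
  have X_range: "X \<omega> \<in> I \<times> UNIV \<times> UNIV" for \<omega>
    by (simp add: X_def I_def history_def del: upt_Suc)
  define f where "f Y = (\<lambda>(\<eta>, s', u). if \<eta> \<in> Y \<and> last (fst \<eta>) = (s, a) then g s' u else 0)"
    for Y :: "('s, 'a) history set"
  have noise_eq: "indicator (history S A U t -` Y \<inter> space M) \<omega> * transition_noise g s a t \<omega> = f Y (X \<omega>)"
    if "\<omega> \<in> space M" for Y \<omega>
    using that by (auto simp: f_def X_def transition_noise_def history_def indicator_def)
  have expect: "expectation (\<lambda>\<omega>. f Y (X \<omega>)) = 0" for Y
  proof -
    have "expectation (\<lambda>\<omega>. f Y (X \<omega>)) = (\<Sum>z\<in>I \<times> UNIV \<times> UNIV. f Y z * \<P>(\<omega> in M. X \<omega> = z))"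
      by (rule finite_range_expectation(1)[OF X_meas _ X_range]) (use I in auto)
    also have "\<dots> = (\<Sum>\<eta>\<in>I. \<Sum>s'\<in>UNIV. \<Sum>u\<in>UNIV. f Y (\<eta>, s', u) * \<P>(\<omega> in M. X \<omega> = (\<eta>, s', u)))"
      by (simp add: sum.cartesian_product)
    also have "\<dots> = 0"
    proof (rule sum.neutral, rule ballI)
      fix \<eta> assume "\<eta> \<in> I"
      show "(\<Sum>s'\<in>UNIV. \<Sum>u\<in>UNIV. f Y (\<eta>, s', u) * \<P>(\<omega> in M. X \<omega> = (\<eta>, s', u))) = 0"
      proof (cases "\<eta> \<in> Y \<and> last (fst \<eta>) = (s, a)")
        case True
        have ne: "fst \<eta> \<noteq> []" using \<open>\<eta> \<in> I\<close> by (auto simp: I_def)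
        have "(\<Sum>s'\<in>UNIV. \<Sum>u\<in>UNIV. f Y (\<eta>, s', u) * \<P>(\<omega> in M. X \<omega> = (\<eta>, s', u)))
            = (\<Sum>s'\<in>UNIV. \<Sum>u\<in>UNIV. \<P>(\<omega> in M. history S A U t \<omega> = \<eta>) *
                (pmf (p s a) s' * pmf (\<pi> s') u * g s' u))"
          using True ne by (simp add: f_def X_def prob_history_transition mult_ac)
        also have "\<dots> = 0"
          by (simp only: sum_distrib_left[symmetric] mean)
        finally show ?thesis .
      qed (auto simp: f_def)
    qed
    finally show ?thesis .
  qed
  show ?thesis
  proof (rule real_cond_exp_charact)
    have "integrable M (\<lambda>\<omega>. f UNIV (X \<omega>))"
      by (rule finite_range_expectation(2)[OF X_meas _ X_range]) (use I in auto)
    moreover have "transition_noise g s a t \<omega> = f UNIV (X \<omega>)" if "\<omega> \<in> space M" for \<omega>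
      using noise_eq[of \<omega> UNIV] that by simp
    ultimately show "integrable M (transition_noise g s a t)"
      by (subst Bochner_Integration.integrable_cong[OF refl])
    fix Z assume "Z \<in> sets (filt t)"
    then obtain Y where Z: "Z = history S A U t -` Y \<inter> space M"
      by (auto simp: sets_filt)
    have "(\<integral>\<omega>\<in>Z. transition_noise g s a t \<omega> \<partial>M) = expectation (\<lambda>\<omega>. f Y (X \<omega>))"
      unfolding set_lebesgue_integral_def Z
      by (rule Bochner_Integration.integral_cong) (auto simp: noise_eq)
    then show "(\<integral>\<omega>\<in>Z. transition_noise g s a t \<omega> \<partial>M) = (\<integral>\<omega>\<in>Z. 0 \<partial>M)"
      by (simp add: expect set_lebesgue_integral_def)
  qed auto
qed

lemma AE_summable_weighted_noise:
  assumes mean: "(\<Sum>s'\<in>UNIV. \<Sum>u\<in>UNIV. pmf (p s a) s' * pmf (\<pi> s') u * g s' u) = 0"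
    and c: "\<And>t. c t \<in> borel_measurable (filt t)"
    and sq: "AE \<omega> in M. summable (\<lambda>t. (c t \<omega>)\<^sup>2)"
  shows "AE \<omega> in M. summable (\<lambda>t. c t \<omega> * transition_noise g s a t \<omega>)"
proof -
  \<comment> \<open>Finiteness of the state and action types makes any \<open>g\<close>
    bounded.\<close>
  define B where "B = (\<Sum>s'\<in>UNIV. \<Sum>u\<in>UNIV. \<bar>g s' u\<bar>)"
  have g_le: "\<bar>g s' u\<bar> \<le> B" for s' u
    unfolding B_def sum.cartesian_product
    using member_le_sum[of "(s', u)" "UNIV \<times> UNIV" "\<lambda>(s', u). \<bar>g s' u\<bar>"] by auto
  interpret noise: bounded_martingale_differences M filt "transition_noise g s a" B
  proof unfold_locales
    show "\<bar>transition_noise g s a t \<omega>\<bar> \<le> B" for t \<omega>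
      using g_le order_trans[OF abs_ge_zero g_le] by (auto simp: transition_noise_def)
  qed (rule subalgebra_filt subalgebra_filt_Suc transition_noise_measurable
      transition_noise_cond_exp[OF mean])+
  show ?thesis by (rule noise.AE_summable_weighted[OF c sq])
qed

end

section \<open>Convergence of the iterates\<close>

text \<open>Translates the step-size conditions along visit times into conditions on weights that
  vanish off the visits.\<close>

lemma summable_enumerate_iff:
  fixes f :: "nat \<Rightarrow> real"
  assumes "infinite V"
  shows "summable (\<lambda>n. f (enumerate V n)) \<longleftrightarrow> summable (\<lambda>t. if t \<in> V then f t else 0)"
proof -
  have "summable (\<lambda>n. (\<lambda>t. if t \<in> V then f t else 0) (enumerate V n))
      \<longleftrightarrow> summable (\<lambda>t. if t \<in> V then f t else 0)"
    using assms by (intro summable_mono_reindex strict_mono_enumerate) (auto simp: range_enumerate)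
  then show ?thesis using assms by (simp add: enumerate_in_set)
qed

lemma filterlim_at_top_imp_not_summable:
  fixes f :: "nat \<Rightarrow> real"
  assumes "filterlim (\<lambda>N. \<Sum>n<N. f n) at_top sequentially"
  shows "\<not> summable f"
proof
  assume "summable f"
  then have "(\<lambda>N. \<Sum>n<N. f n) \<longlonglongrightarrow> suminf f" by (rule summable_LIMSEQ)
  with assms show False
    using not_tendsto_and_filterlim_at_infinity[OF trivial_limit_sequentially]
      filterlim_at_top_imp_at_infinity by fast
qed

text \<open>The induction step on a single sample path, with no probability left: replacing the
  iterate of horizon \<open>h\<close> in the target by its limit leaves the noise \<open>w\<close>,
  and the replacement error is the bias.\<close>

lemma fhtd_tendsto_Suc:
  fixes r :: "'s::finite \<Rightarrow> 'a::finite \<Rightarrow> 's \<Rightarrow> real" and \<gamma> q :: real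
    and Q0 :: "nat \<Rightarrow> 's \<Rightarrow> 'a \<Rightarrow> real" and lr :: "nat \<Rightarrow> nat \<Rightarrow> 's \<Rightarrow> 'a \<Rightarrow> real"
    and st :: "nat \<Rightarrow> 's" and ac au :: "nat \<Rightarrow> 'a"
  defines "Q \<equiv> fhtd r \<gamma> Q0 lr st ac au"
  assumes prev: "\<And>s' u. (\<lambda>t. Q t h s' u) \<longlonglongrightarrow> Qh s' u"
    and pos: "\<And>t. lr t (Suc h) s a > 0"
    and weight: "\<And>t. c t = (if st t = s \<and> ac t = a then lr t (Suc h) s a else 0)"
    and div: "\<not> summable c"
    and sq: "summable (\<lambda>t. (c t)\<^sup>2)"
    and noise: "summable (\<lambda>t. c t * w t)"
    and w: "\<And>t. st t = s \<Longrightarrow> ac t = a \<Longrightarrow> w t = r s a (st (Suc t)) + \<gamma> * Qh (st (Suc t)) (au (Suc t)) - q"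
  shows "(\<lambda>t. Q t (Suc h) s a) \<longlonglongrightarrow> q"
proof -
  have c_nonneg: "0 \<le> c t" for t
    using pos[of t] by (simp add: weight)
  have "(\<lambda>t. sqrt ((c t)\<^sup>2)) \<longlonglongrightarrow> sqrt 0"
    by (intro tendsto_real_sqrt summable_LIMSEQ_zero[OF sq])
  then have c_lim: "c \<longlonglongrightarrow> 0"
    using c_nonneg by simp
  define b where "b t = \<gamma> * (Q t h (st (Suc t)) (au (Suc t)) - Qh (st (Suc t)) (au (Suc t)))" for t
  \<comment> \<open>The pair in the target changes with \<open>t\<close>, so convergence must be
    uniform over pairs. Summing over the finitely many pairs provides this.\<close>
  define e where "e t = (\<Sum>(s', u)\<in>UNIV. \<bar>Q t h s' u - Qh s' u\<bar>)" for t
  have "(\<lambda>t. \<bar>Q t h s' u - Qh s' u\<bar>) \<longlonglongrightarrow> 0" for s' u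
    by (intro tendsto_rabs_zero LIM_zero prev)
  then have "e \<longlonglongrightarrow> 0"
    unfolding e_def by (intro tendsto_null_sum) auto
  then have e_lim: "(\<lambda>t. \<bar>\<gamma>\<bar> * e t) \<longlonglongrightarrow> 0"
    by (rule tendsto_mult_right_zero)
  have b_le: "norm (b t) \<le> \<bar>\<gamma>\<bar> * e t" for t
  proof -
    have "\<bar>Q t h s' u - Qh s' u\<bar> \<le> e t" for s' u
      unfolding e_def
      using member_le_sum[of "(s', u)" UNIV "\<lambda>(s', u). \<bar>Q t h s' u - Qh s' u\<bar>"] by auto
    then show ?thesis
      unfolding b_def real_norm_def abs_mult by (intro mult_left_mono) auto
  qed
  have b_lim: "b \<longlonglongrightarrow> 0"
    by (rule Lim_null_comparison[OF always_eventually e_lim]) (use b_le in blast)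
  have "(\<lambda>t. Q t (Suc h) s a - q) \<longlonglongrightarrow> 0"
  proof (rule noisy_averaging_tendsto_0[OF c_nonneg c_lim div b_lim noise])
    show "Q (Suc t) (Suc h) s a - q
        = Q t (Suc h) s a - q + c t * (w t + b t - (Q t (Suc h) s a - q))" for t
      \<comment> \<open>At a visit this is the update rule; at any other time \<open>c t = 0\<close>
        and the iterate is unchanged.\<close>
      by (auto simp: Q_def Let_def weight w b_def[unfolded Q_def] algebra_simps)
  qed
  then show ?thesis by (rule LIM_zero_cancel)
qed

theorem theorem3:
  fixes M :: "'w measure"
    and p :: "'s::finite \<Rightarrow> 'a::finite \<Rightarrow> 's pmf"
    and r :: "'s \<Rightarrow> 'a \<Rightarrow> 's \<Rightarrow> real"
    and \<gamma> :: real
    and \<pi> :: "'s \<Rightarrow> 'a pmf"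
    and H :: nat
    and \<beta> :: "nat \<Rightarrow> 's \<Rightarrow> 'a pmf"
    and S :: "nat \<Rightarrow> 'w \<Rightarrow> 's"
    and A U :: "nat \<Rightarrow> 'w \<Rightarrow> 'a"
    and \<alpha> :: "nat \<Rightarrow> nat \<Rightarrow> ('s, 'a) history \<Rightarrow> 's \<Rightarrow> 'a \<Rightarrow> real"
    and Q0 :: "nat \<Rightarrow> 's \<Rightarrow> 'a \<Rightarrow> real"
  defines "rate \<equiv> \<lambda>\<omega> t h s a. \<alpha> t h (history S A U t \<omega>) s a"
  assumes reward: "\<And>s a s'. r s a s' \<in> {-1..1}"
    and discount: "\<gamma> \<in> {0..1}"
    and horizon: "H \<ge> 1"
    and process: "behaviour_process M p \<pi> \<beta> S A U"
    and visited: "AE \<omega> in M. \<forall>s a. infinite (visits S A s a \<omega>)"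
    and rate_pos: "\<And>h s a. h \<in> {1..H} \<Longrightarrow> AE \<omega> in M. \<forall>t. rate \<omega> t h s a > 0"
    and rate_decseq: "\<And>h s a. h \<in> {1..H} \<Longrightarrow> AE \<omega> in M. decseq (\<lambda>t. rate \<omega> t h s a)"
    and rate_sum: "\<And>h s a. h \<in> {1..H} \<Longrightarrow> AE \<omega> in M.
        filterlim (\<lambda>N. \<Sum>n<N. rate \<omega> (enumerate (visits S A s a \<omega>) n) h s a) at_top sequentially"
    and rate_sum_sq: "\<And>h s a. h \<in> {1..H} \<Longrightarrow> AE \<omega> in M.
        summable (\<lambda>n. (rate \<omega> (enumerate (visits S A s a \<omega>) n) h s a)\<^sup>2)"
  shows "\<forall>h\<in>{1..H}. \<forall>s a. AE \<omega> in M.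
    (\<lambda>t. fhtd r \<gamma> Q0 (rate \<omega>) (\<lambda>i. S i \<omega>) (\<lambda>i. A i \<omega>) (\<lambda>i. U i \<omega>) t h s a)
      \<longlonglongrightarrow> Q_value p r \<gamma> \<pi> h s a"
proof -
  interpret behaviour_process M p \<pi> \<beta> S A U by (rule process)
  let ?Q = "\<lambda>\<omega>. fhtd r \<gamma> Q0 (rate \<omega>) (\<lambda>i. S i \<omega>) (\<lambda>i. A i \<omega>) (\<lambda>i. U i \<omega>)"
  let ?V = "Q_value p r \<gamma> \<pi>"
  \<comment> \<open>The induction starts at the trivial horizon 0 and treats all pairs at once,
    since the update at one pair may bootstrap from any other.\<close>
  have "AE \<omega> in M. \<forall>s a. (\<lambda>t. ?Q \<omega> t h s a) \<longlonglongrightarrow> ?V h s a" if "h \<le> H" for h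
    using that
  proof (induction h)
    case 0
    have "?Q \<omega> t 0 s a = 0" for \<omega> t s a
      by (cases t) (simp_all add: Let_def)
    then show ?case by (simp add: Q_value_0)
  next
    case (Suc h)
    then have IH: "AE \<omega> in M. \<forall>s a. (\<lambda>t. ?Q \<omega> t h s a) \<longlonglongrightarrow> ?V h s a"
      and h: "Suc h \<in> {1..H}" by auto
    have "AE \<omega> in M. (\<lambda>t. ?Q \<omega> t (Suc h) s a) \<longlonglongrightarrow> ?V (Suc h) s a" for s a
    proof -
      \<comment> \<open>The exact target of horizon \<open>h\<close>, centred at its mean, which is
        the value at horizon \<open>Suc h\<close> by the Bellman recursion.\<close>
      define g where "g s' u = r s a s' + \<gamma> * ?V h s' u - ?V (Suc h) s a" for s' u
      have "(\<Sum>s'\<in>UNIV. \<Sum>u\<in>UNIV. pmf (p s a) s' * pmf (\<pi> s') u) = 1"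
        by (simp add: sum_distrib_left[symmetric] sum_pmf_UNIV)
      then have mean: "(\<Sum>s'\<in>UNIV. \<Sum>u\<in>UNIV. pmf (p s a) s' * pmf (\<pi> s') u * g s' u) = 0"
        by (simp add: g_def right_diff_distrib sum_subtractf Q_value_Suc[symmetric]
            sum_distrib_right[symmetric])
      define c where "c t \<omega> = (if t \<in> visits S A s a \<omega> then rate \<omega> t (Suc h) s a else 0)" for t \<omega>
      have c_meas: "c t \<in> borel_measurable (filt t)" for t
      proof (rule measurable_filtI)
        show "c t \<omega> = (\<lambda>\<eta>. if fst \<eta> ! t = (s, a) then \<alpha> t (Suc h) \<eta> s a else 0) (history S A U t \<omega>)" for \<omega>
          by (simp add: c_def visits_def rate_def history_nth_state)
      qed simp
      have c_sq: "AE \<omega> in M. summable (\<lambda>t. (c t \<omega>)\<^sup>2)"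
        using visited rate_sum_sq[OF h, of s a]
      proof eventually_elim
        case (elim \<omega>)
        then have "summable (\<lambda>t. if t \<in> visits S A s a \<omega> then (rate \<omega> t (Suc h) s a)\<^sup>2 else 0)"
          using summable_enumerate_iff[of "visits S A s a \<omega>" "\<lambda>t. (rate \<omega> t (Suc h) s a)\<^sup>2"] by simp
        then show ?case
          by (rule back_subst[of summable]) (auto simp: c_def)
      qed
      show ?thesis
        using IH visited rate_pos[OF h, of s a] rate_sum[OF h, of s a] c_sq
          AE_summable_weighted_noise[OF mean c_meas c_sq]
      proof eventually_elim
        case (elim \<omega>)
        show ?case
        proof (rule fhtd_tendsto_Suc)
          show "(\<lambda>t. ?Q \<omega> t h s' u) \<longlonglongrightarrow> ?V h s' u" for s' u
            using elim(1) by blast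
          show "rate \<omega> t (Suc h) s a > 0" for t
            using elim(3) by blast
          show "c t \<omega> = (if S t \<omega> = s \<and> A t \<omega> = a then rate \<omega> t (Suc h) s a else 0)" for t
            by (simp add: c_def visits_def)
          show "\<not> summable (\<lambda>t. c t \<omega>)"
            \<comment> \<open>Since the visits are infinite, their enumeration is faithful and
              divergence along it is divergence of \<open>c\<close>.\<close>
            using elim(2) filterlim_at_top_imp_not_summable[OF elim(4)]
            by (simp add: c_def summable_enumerate_iff[where f = "\<lambda>t. rate \<omega> t (Suc h) s a"])
          show "summable (\<lambda>t. (c t \<omega>)\<^sup>2)"
            by (rule elim(5))
          show "summable (\<lambda>t. c t \<omega> * transition_noise g s a t \<omega>)"
            by (rule elim(6))
          show "transition_noise g s a t \<omega>
              = r s a (S (Suc t) \<omega>) + \<gamma> * ?V h (S (Suc t) \<omega>) (U (Suc t) \<omega>) - ?V (Suc h) s a"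
            if "S t \<omega> = s" "A t \<omega> = a" for t
            using that by (simp add: transition_noise_def g_def)
        qed
      qed
    qed
    then show ?case by (simp add: AE_all_countable)
  qed
  then show ?thesis by (auto simp: AE_all_countable)
qed

end
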